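(* Let $X$ be a real or complex Banach space and let $(A(n))_{n\in\mathbb{N}}$ be a sequence in $\mathcal{B}(X)$. The linear discrete-time system $x_{n+1}=A(n)x_n$, $n\in\mathbb{N}$, is nonuniformly power instable (NPIS) if and only if there are constants $d>1$, $p\in(0,+\infty)$ and a nondecreasing sequence $\theta:\mathbb{N}\to[1,+\infty)$ such that $$\sum_{k=n}^{m} d^{\,p(m-k)}\,\|\mathcal{A}(k,n)x\|^{p}\le \theta(m)^{p}\,\|\mathcal{A}(m,n)x\|^{p}$$ for all $(m,n,x)\in\Delta\times X$.
   Context: $\mathcal{B}(X)$ is the space of bounded linear operators on $X$; $\|\cdot\|$ denotes the norm on $X$. $\mathbb{N}=\{0,1,2,\dots\}$ and $\Delta=\{(m,n)\in\mathbb{N}^2: m\ge n\}$. For $(m,n)\in\Delta$, $\mathcal{A}(m,n)=A(m-1)\cdots A(n)$ if $m\ge n+1$ and $\mathcal{A}(n,n)=I$ (the identity). The system is nonuniformly power instable (NPIS) if there exist a nondecreasing sequence $N:\mathbb{N}\to[1,\infty)$ and $r\in(0,1)$ such that $\|\mathcal{A}(n,l)x\|\le N(m)\,r^{m-n}\,\|\mathcal{A}(m,l)x\|$ for all $m,n,l\in\mathbb{N}$ with $m\ge n\ge l$ and all $x\in X$. *)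

theory Defs
  imports "HOL-Analysis.Analysis"
begin

text \<open>
  The state space is a type of class \<^class>\<open>banach\<close>, and \<open>'a \<Rightarrow>\<^sub>L 'a\<close> are its bounded
  real-linear operators. A complex Banach space is covered by restriction of scalars: it is a
  Banach space over the reals with the same norm, and its bounded complex-linear operators are in
  particular bounded real-linear ones.
\<close>

text \<open>
  \<open>evol A m n\<close> is \<open>A (m - 1) \<cdots> A n\<close>. Only arguments with \<open>n \<le> m\<close> are meaningful; the value is
  the identity for \<open>m < n\<close>.
\<close>

primrec evol :: "(nat \<Rightarrow> 'a::real_normed_vector \<Rightarrow>\<^sub>L 'a) \<Rightarrow> nat \<Rightarrow> nat \<Rightarrow> 'a \<Rightarrow>\<^sub>L 'a" where
  "evol A 0 n = id_blinfun"
| "evol A (Suc m) n = (if n \<le> m then A m o\<^sub>L evol A m n else id_blinfun)"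

lemma evol_refl: "evol A n n = id_blinfun"
  by (cases n) auto

lemma evol_Suc: "n \<le> m \<Longrightarrow> evol A (Suc m) n = A m o\<^sub>L evol A m n"
  by simp

definition npis :: "(nat \<Rightarrow> 'a::real_normed_vector \<Rightarrow>\<^sub>L 'a) \<Rightarrow> bool" where
  "npis A \<longleftrightarrow>
    (\<exists>(N :: nat \<Rightarrow> real) (r :: real).
      mono N \<and> (\<forall>m. 1 \<le> N m) \<and> 0 < r \<and> r < 1 \<and>
      (\<forall>m n l x. l \<le> n \<longrightarrow> n \<le> m \<longrightarrow>
        norm (evol A n l x) \<le> N m * r ^ (m - n) * norm (evol A m l x)))"

end

theory Submission
  imports Defs
begin

text \<open>
  This is a discrete Datko-type characterization in which the exponential weight already carries
  the decay, so both directions are elementary. If the system is nonuniformly power instable with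
  rate \<open>r\<close>, then with exponent \<open>p = 1\<close> any weight base \<open>d\<close> strictly between \<open>1\<close> and \<open>1 / r\<close> keeps
  the ratio \<open>d r\<close> below \<open>1\<close>, and the weighted sum is dominated by a geometric series
  (\<open>geometric_weight_sum_le\<close>). Conversely, every term of the sum is nonnegative, so each one alone
  is bounded by the right-hand side; a \<open>p\<close>-th root turns that into an instability estimate with
  rate \<open>1 / d\<close> and the same sequence \<open>\<theta>\<close> (\<open>weighted_sum_bound_imp_term_bound\<close>).
\<close>

text \<open>Summed backwards from \<open>m\<close>, the terms are at most \<open>C (d r)\<^sup>j\<close> with \<open>j = m - k\<close>.\<close>

lemma geometric_weight_sum_le:
  fixes a :: "nat \<Rightarrow> real"
  assumes "0 < d" "0 < r" "d * r < 1" "0 \<le> C" "n \<le> m"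
    and bound: "\<And>k. n \<le> k \<Longrightarrow> k \<le> m \<Longrightarrow> a k \<le> C * r ^ (m - k)"
  shows "(\<Sum>k=n..m. d ^ (m - k) * a k) \<le> C / (1 - d * r)"
proof -
  have "(\<Sum>k=n..m. d ^ (m - k) * a k) \<le> (\<Sum>k=n..m. C * (d * r) ^ (m - k))"
  proof (rule sum_mono)
    fix k assume "k \<in> {n..m}"
    then have "d ^ (m - k) * a k \<le> d ^ (m - k) * (C * r ^ (m - k))"
      using bound assms(1) by (intro mult_left_mono) auto
    then show "d ^ (m - k) * a k \<le> C * (d * r) ^ (m - k)"
      by (simp add: power_mult_distrib mult_ac)
  qed
  also have "\<dots> = C * (\<Sum>j\<le>m - n. (d * r) ^ j)"
    unfolding sum_distrib_left[symmetric]
    using \<open>n \<le> m\<close>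
    by (intro arg_cong[where f = "(*) C"]
        sum.reindex_bij_witness[where i = "\<lambda>j. m - j" and j = "\<lambda>k. m - k"]) auto
  also have "\<dots> \<le> C * (1 / (1 - d * r))"
  proof (intro mult_left_mono)
    have "(\<Sum>j\<le>m - n. (d * r) ^ j) \<le> (\<Sum>j. (d * r) ^ j)"
      using assms by (intro sum_le_suminf summable_geometric) auto
    then show "(\<Sum>j\<le>m - n. (d * r) ^ j) \<le> 1 / (1 - d * r)"
      using assms by (simp add: suminf_geometric)
  qed (use assms in auto)
  finally show ?thesis by simp
qed

lemma weighted_sum_bound_imp_term_bound:
  fixes a :: "nat \<Rightarrow> real"
  assumes "0 < d" "0 < p" "0 \<le> T" "\<And>k. 0 \<le> a k" "n \<le> k" "k \<le> m"
    and sum_le: "(\<Sum>i=n..m. d powr (p * real (m - i)) * a i powr p) \<le> T powr p * a m powr p"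
  shows "a k \<le> T * (1 / d) ^ (m - k) * a m"
proof -
  have "d powr (p * real (m - k)) * a k powr p
      \<le> (\<Sum>i=n..m. d powr (p * real (m - i)) * a i powr p)"
    using assms by (intro member_le_sum[of k "{n..m}"]) auto
  also note sum_le
  also have "T powr p * a m powr p = (T * a m) powr p"
    using assms by (simp add: powr_mult)
  also have "d powr (p * real (m - k)) * a k powr p = (d ^ (m - k) * a k) powr p"
    using assms by (simp add: powr_mult powr_powr mult.commute flip: powr_realpow)
  finally have "d ^ (m - k) * a k \<le> T * a m"
    using assms by (meson mult_nonneg_nonneg not_le powr_less_mono2)
  then show ?thesis
    using assms(1) by (simp add: field_simps)
qed

theorem theorem3:
  fixes A :: "nat \<Rightarrow> 'a::banach \<Rightarrow>\<^sub>L 'a"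
  shows "npis A \<longleftrightarrow>
    (\<exists>(d :: real) (p :: real) (\<theta> :: nat \<Rightarrow> real).
      1 < d \<and> 0 < p \<and> mono \<theta> \<and> (\<forall>m. 1 \<le> \<theta> m) \<and>
      (\<forall>m n x. n \<le> m \<longrightarrow>
        (\<Sum>k=n..m. d powr (p * real (m - k)) * norm (evol A k n x) powr p)
          \<le> \<theta> m powr p * norm (evol A m n x) powr p))"
    (is "_ \<longleftrightarrow> ?summable")
proof
  assume "npis A"
  then obtain N r where N: "mono N" "\<And>m. 1 \<le> N m" and r: "0 < r" "r < 1"
    and bound: "\<And>m n l x. l \<le> n \<Longrightarrow> n \<le> m \<Longrightarrow>
        norm (evol A n l x) \<le> N m * r ^ (m - n) * norm (evol A m l x)"
    unfolding npis_def by blast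
  \<comment> \<open>A base above \<open>1\<close> whose product with \<open>r\<close> stays below \<open>1\<close>.\<close>
  define d where "d = 2 / (1 + r)"
  have d: "1 < d" "d * r < 1"
    using r by (auto simp: d_def field_simps)
  have dr0: "0 < d * r" using d r by simp
  define \<theta> where "\<theta> m = N m / (1 - d * r)" for m
  have "mono \<theta>"
    using N(1) d by (auto simp: mono_def \<theta>_def divide_right_mono)
  moreover have \<theta>_ge: "1 \<le> \<theta> m" for m
    using N(2)[of m] d dr0 by (simp add: \<theta>_def field_simps)
  moreover have "(\<Sum>k=n..m. d powr (1 * real (m - k)) * norm (evol A k n x) powr 1)
      \<le> \<theta> m powr 1 * norm (evol A m n x) powr 1" if "n \<le> m" for m n x
  proof -
    have "(\<Sum>k=n..m. d ^ (m - k) * norm (evol A k n x))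
        \<le> (N m * norm (evol A m n x)) / (1 - d * r)"
      using d r that bound N(2)[of m]
      by (intro geometric_weight_sum_le) (auto simp: mult_ac)
    then show ?thesis
      using d \<theta>_ge[of m] by (simp add: powr_realpow \<theta>_def del: of_nat_diff)
  qed
  ultimately show ?summable
    using d(1) by (intro exI[of _ d] exI[of _ "1::real"] exI[of _ \<theta>]) auto
next
  assume ?summable
  then obtain d p \<theta> where d: "1 < d" and p: "0 < p" and \<theta>: "mono \<theta>" "\<And>m. 1 \<le> \<theta> m"
    and sum_le: "\<And>m n x. n \<le> m \<Longrightarrow>
        (\<Sum>k=n..m. d powr (p * real (m - k)) * norm (evol A k n x) powr p)
          \<le> \<theta> m powr p * norm (evol A m n x) powr p"
    by blast
  have "norm (evol A n l x) \<le> \<theta> m * (1 / d) ^ (m - n) * norm (evol A m l x)"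
    if "l \<le> n" "n \<le> m" for m n l x
    using that d p \<theta>(2)[of m] sum_le[of l m x]
    by (intro weighted_sum_bound_imp_term_bound[where n = l and p = p]) auto
  then show "npis A"
    unfolding npis_def using d \<theta> by (intro exI[of _ \<theta>] exI[of _ "1 / d"]) auto
qed

end
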